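(* Let $R=\{(0,0),(0,1),(2,0),(3,0),(1,2),(2,2),(3,1),(3,2),(3,3)\}$ and $R'=\{(0,0),(1,0),(0,2),(0,3),(1,3),(2,1),(2,2),(2,3),(3,3)\}$. Then $(123,R)\sim_{jd}(132,R)$ and $(123,R')\sim_{jd}(132,R')$.
   Context: $S_n$ is the set of permutations $\pi=\pi_1\cdots\pi_n$ of $\{1,\dots,n\}$. A mesh pattern of length $k$ is a pair $(\tau,R)$ with $\tau\in S_k$ and $R\subseteq\{0,\dots,k\}\times\{0,\dots,k\}$ (the set of shaded boxes; box $(a,b)$ is the unit square with lower-left corner $(a,b)$). An occurrence of $(\tau,R)$ in $\pi\in S_n$ is a subsequence $\pi_{i_1}\cdots\pi_{i_k}$, $i_1<\dots<i_k$, order-isomorphic to $\tau$, such that, with $i_0=0$, $i_{k+1}=n+1$, with $v_1<\dots<v_k$ the values $\pi_{i_1},\dots,\pi_{i_k}$ in increasing order, and $v_0=0$, $v_{k+1}=n+1$, for each $(a,b)\in R$ there is no index $m$ with $i_a<m<i_{a+1}$ and $v_b<\pi_m<v_{b+1}$. Two mesh patterns $q_1,q_2$ are jointly equidistributed, written $q_1\sim_{jd}q_2$, if for all nonnegative integers $n,k,\ell$ the number of $\pi\in S_n$ with exactly $k$ occurrences of $q_1$ and $\ell$ occurrences of $q_2$ equals the number of $\pi\in S_n$ with exactly $\ell$ occurrences of $q_1$ and $k$ occurrences of $q_2$. *)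

theory Defs
  imports "HOL-Combinatorics.Multiset_Permutations"
begin

text \<open>Permutations of \<open>{1..n}\<close> are words in one-line notation, i.e. the elements of
  \<^term>\<open>permutations_of_set {1..n}\<close>. Positions are counted from 1, as in \<open>\<pi>\<^sub>1 \<cdots> \<pi>\<^sub>n\<close>.\<close>

definition entry :: "nat list \<Rightarrow> nat \<Rightarrow> nat" where
  "entry \<pi> i = \<pi> ! (i - 1)"

text \<open>A pair \<open>(\<tau>, R)\<close> is a mesh pattern of length \<open>k\<close> if \<open>\<tau> \<in> permutations_of_set {1..k}\<close> and
  \<open>R \<subseteq> {0..k} \<times> {0..k}\<close>; the length is \<^term>\<open>length \<tau>\<close>. The type does not enforce these
  conditions.\<close>

type_synonym mesh_pattern = "nat list \<times> (nat \<times> nat) set"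

definition order_isomorphic :: "nat list \<Rightarrow> nat list \<Rightarrow> bool" where
  "order_isomorphic xs ys \<longleftrightarrow> length xs = length ys \<and>
     (\<forall>a < length xs. \<forall>b < length xs. xs ! a < xs ! b \<longleftrightarrow> ys ! a < ys ! b)"

text \<open>An occurrence is given by its list of positions \<open>i\<^sub>1 < \<dots> < i\<^sub>k\<close>. The lists \<open>I\<close> and \<open>V\<close> below
  are \<open>i\<^sub>0, \<dots>, i\<^sub>k\<^sub>+\<^sub>1\<close> and \<open>v\<^sub>0, \<dots>, v\<^sub>k\<^sub>+\<^sub>1\<close>, including the conventions \<open>i\<^sub>0 = v\<^sub>0 = 0\<close> and
  \<open>i\<^sub>k\<^sub>+\<^sub>1 = v\<^sub>k\<^sub>+\<^sub>1 = n + 1\<close>.\<close>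

definition is_occurrence :: "mesh_pattern \<Rightarrow> nat list \<Rightarrow> nat list \<Rightarrow> bool" where
  "is_occurrence q \<pi> ps \<longleftrightarrow>
     (let \<tau> = fst q; R = snd q; n = length \<pi>;
          I = 0 # ps @ [n + 1];
          V = 0 # sort (map (entry \<pi>) ps) @ [n + 1]
      in sorted_wrt (<) ps \<and> set ps \<subseteq> {1..n} \<and>
         order_isomorphic (map (entry \<pi>) ps) \<tau> \<and>
         (\<forall>(a, b) \<in> R. \<not> (\<exists>m \<in> {1..n}.
            I ! a < m \<and> m < I ! (a + 1) \<and> V ! b < entry \<pi> m \<and> entry \<pi> m < V ! (b + 1))))"

definition num_occurrences :: "mesh_pattern \<Rightarrow> nat list \<Rightarrow> nat" where
  "num_occurrences q \<pi> = card {ps. is_occurrence q \<pi> ps}"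

definition jointly_equidistributed :: "mesh_pattern \<Rightarrow> mesh_pattern \<Rightarrow> bool"  (infix "\<sim>\<^sub>j\<^sub>d" 50) where
  "q1 \<sim>\<^sub>j\<^sub>d q2 \<longleftrightarrow> (\<forall>n k l.
     card {\<pi> \<in> permutations_of_set {1..n}. num_occurrences q1 \<pi> = k \<and> num_occurrences q2 \<pi> = l} =
     card {\<pi> \<in> permutations_of_set {1..n}. num_occurrences q1 \<pi> = l \<and> num_occurrences q2 \<pi> = k})"

end

theory Submission
  imports Defs
begin

text \<open>Exchanging the last two letters of an occurrence of \<open>(123, R)\<close> in \<open>\<pi>\<close> turns it into an
  occurrence of \<open>(132, R)\<close> at the same positions, since neither the grid lines nor the remaining
  points of \<open>\<pi>\<close> move. Hence both patterns have the same total number of occurrences in \<open>S\<^sub>n\<close>, for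
  every \<open>R\<close>. For the two given shadings every permutation contains each pattern at most once, so
  equal totals mean that equally many permutations contain the first pattern and the second one;
  removing those that contain both gives joint equidistribution.\<close>

section \<open>Shaded boxes with explicit grid lines for patterns of length 3\<close>

definition avoids_boxes ::
    "(nat \<times> nat) set \<Rightarrow> nat \<Rightarrow> (nat \<Rightarrow> nat) \<Rightarrow> nat list \<Rightarrow> nat list \<Rightarrow> bool" where
  "avoids_boxes R n e I V \<longleftrightarrow> (\<forall>(a, b) \<in> R. \<forall>m \<in> {1..n}.
     \<not> (I ! a < m \<and> m < I ! (a + 1) \<and> V ! b < e m \<and> e m < V ! (b + 1)))"

text \<open>Boxes are open, so a position inside a shaded column may still carry a letter on a
  horizontal grid line; hence both alternatives are non-strict. Where a strict bound is wanted
  later, injectivity of \<open>e\<close> excludes equality.\<close>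

lemma avoids_boxesD:
  assumes "avoids_boxes R n e I V" "(a, b) \<in> R" "1 \<le> m" "m \<le> n" "I ! a < m" "m < I ! (a + 1)"
  shows "e m \<le> V ! b \<or> V ! (b + 1) \<le> e m"
proof -
  have "\<forall>m\<in>{1..n}. \<not> (I ! a < m \<and> m < I ! (a + 1) \<and> V ! b < e m \<and> e m < V ! (b + 1))"
    using bspec[OF assms(1)[unfolded avoids_boxes_def] assms(2)] by simp
  from bspec[OF this, of m] show ?thesis using assms(3-) by auto
qed

lemma length_eq_3_conv: "length xs = 3 \<longleftrightarrow> (\<exists>a b c. xs = [a, b, c])"
  by (auto simp: length_Suc_conv eval_nat_numeral)

text \<open>Order isomorphism to 123 says that the three letters are already sorted, so
  \<open>sort\<close> disappears from the value grid.\<close>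

lemma is_occurrence_123_iff:
  assumes "length \<pi> = n"
  shows "is_occurrence ([1,2,3], R) \<pi> ps \<longleftrightarrow>
    (\<exists>i j k. ps = [i, j, k] \<and> 1 \<le> i \<and> i < j \<and> j < k \<and> k \<le> n \<and>
       entry \<pi> i < entry \<pi> j \<and> entry \<pi> j < entry \<pi> k \<and>
       avoids_boxes R n (entry \<pi>) [0, i, j, k, n + 1]
         [0, entry \<pi> i, entry \<pi> j, entry \<pi> k, n + 1])"
proof (cases "length ps = 3")
  case True
  then obtain i j k where ps: "ps = [i, j, k]" by (auto simp: length_eq_3_conv)
  have iso: "order_isomorphic (map (entry \<pi>) ps) [1,2,3] \<longleftrightarrow>
      entry \<pi> i < entry \<pi> j \<and> entry \<pi> j < entry \<pi> k"
    unfolding ps order_isomorphic_def by (auto simp: All_less_Suc)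
  show ?thesis
    unfolding is_occurrence_def Let_def fst_conv snd_conv iso avoids_boxes_def assms
    by (auto simp: ps)
qed (auto simp: is_occurrence_def order_isomorphic_def)

text \<open>Here sorting exchanges the last two letters, so the second inner value line comes from
  position \<open>k\<close> and the third from position \<open>j\<close>.\<close>

lemma is_occurrence_132_iff:
  assumes "length \<pi> = n"
  shows "is_occurrence ([1,3,2], R) \<pi> ps \<longleftrightarrow>
    (\<exists>i j k. ps = [i, j, k] \<and> 1 \<le> i \<and> i < j \<and> j < k \<and> k \<le> n \<and>
       entry \<pi> i < entry \<pi> k \<and> entry \<pi> k < entry \<pi> j \<and>
       avoids_boxes R n (entry \<pi>) [0, i, j, k, n + 1]
         [0, entry \<pi> i, entry \<pi> k, entry \<pi> j, n + 1])"
proof (cases "length ps = 3")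
  case True
  then obtain i j k where ps: "ps = [i, j, k]" by (auto simp: length_eq_3_conv)
  have iso: "order_isomorphic (map (entry \<pi>) ps) [1,3,2] \<longleftrightarrow>
      entry \<pi> i < entry \<pi> k \<and> entry \<pi> k < entry \<pi> j"
    unfolding ps order_isomorphic_def by (auto simp: All_less_Suc)
  show ?thesis
    unfolding is_occurrence_def Let_def fst_conv snd_conv iso avoids_boxes_def assms
    by (auto simp: ps)
qed (auto simp: is_occurrence_def order_isomorphic_def)

section \<open>Exchanging two letters, and equality of the total numbers of occurrences\<close>

definition swap_entries :: "nat \<Rightarrow> nat \<Rightarrow> nat list \<Rightarrow> nat list" where
  "swap_entries j k \<pi> = \<pi>[j - 1 := entry \<pi> k, k - 1 := entry \<pi> j]"

lemma length_swap_entries [simp]: "length (swap_entries j k \<pi>) = length \<pi>"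
  by (simp add: swap_entries_def)

text \<open>Truncated subtraction makes positions 0 and 1 read the same letter. For
  \<open>j = 1\<close> the formula would fail at \<open>m = 0\<close>, hence the bound
  \<open>1 \<le> m\<close>.\<close>

lemma entry_swap_entries:
  assumes "1 \<le> j" "j < k" "k \<le> length \<pi>" "1 \<le> m"
  shows "entry (swap_entries j k \<pi>) m =
    (if m = j then entry \<pi> k else if m = k then entry \<pi> j else entry \<pi> m)"
  using assms by (auto simp: swap_entries_def entry_def nth_list_update)

lemma swap_entries_swap_entries:
  assumes "1 \<le> j" "j < k" "k \<le> length \<pi>"
  shows "swap_entries j k (swap_entries j k \<pi>) = \<pi>"
  using assms by (auto simp: swap_entries_def entry_def nth_list_update intro!: nth_equalityI)

lemma swap_entries_in_permutations_of_set:
  assumes "\<pi> \<in> permutations_of_set A" "1 \<le> j" "j < k" "k \<le> length \<pi>"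
  shows "swap_entries j k \<pi> \<in> permutations_of_set A"
  using assms by (auto simp: swap_entries_def entry_def permutations_of_set_def set_swap)

text \<open>The columns are open intervals between consecutive grid positions, so none contains
  \<open>j\<close> or \<open>k\<close>, and the letters at all other positions stay. The value grid
  \<open>V\<close> is an argument separate from the letters so that it can remain fixed while they
  change. The bound on \<open>R\<close> keeps the index \<open>a + 1\<close> inside the list of grid
  positions.\<close>

lemma avoids_boxes_swap_entries:
  assumes "1 \<le> i" "i < j" "j < k" "k \<le> length \<pi>" "R \<subseteq> {0..3} \<times> UNIV"
    "avoids_boxes R n (entry \<pi>) [0, i, j, k, n + 1] V"
  shows "avoids_boxes R n (entry (swap_entries j k \<pi>)) [0, i, j, k, n + 1] V"
  unfolding avoids_boxes_def
proof (intro ballI, clarify)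
  fix a b m
  assume ab: "(a, b) \<in> R" and m: "m \<in> {1..n}"
    and box: "[0, i, j, k, n + 1] ! a < m" "m < [0, i, j, k, n + 1] ! (a + 1)"
      "V ! b < entry (swap_entries j k \<pi>) m" "entry (swap_entries j k \<pi>) m < V ! (b + 1)"
  have "a \<in> {0, 1, 2, 3}" using ab assms(5) by auto
  then have "m \<noteq> j \<and> m \<noteq> k" using box(1,2) assms(1-4) by (auto simp: eval_nat_numeral)
  then have "entry (swap_entries j k \<pi>) m = entry \<pi> m"
    using assms(1-4) m by (subst entry_swap_entries) auto
  then show False using assms(6) ab m box unfolding avoids_boxes_def by fastforce
qed

text \<open>The cardinality is the total number of occurrences over all of \<open>S_n\<close>. The
  exchange of letters depends on the chosen occurrence, so it acts on such pairs and not on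
  permutations alone.\<close>

definition occurrence_pairs :: "mesh_pattern \<Rightarrow> nat \<Rightarrow> (nat list \<times> nat list) set" where
  "occurrence_pairs q n = {(\<pi>, ps). \<pi> \<in> permutations_of_set {1..n} \<and> is_occurrence q \<pi> ps}"

lemma length_permutation: "\<pi> \<in> permutations_of_set {1..n} \<Longrightarrow> length \<pi> = n"
  by (simp add: length_finite_permutations_of_set)

text \<open>The letters at \<open>j\<close> and \<open>k\<close> trade places, and the two
  characterisations list these positions in opposite order; the value grid is therefore literally
  the same list before and after.\<close>

lemma is_occurrence_swap_entries:
  assumes "length \<pi> = n" "R \<subseteq> {0..3} \<times> UNIV"
  shows "is_occurrence ([1,2,3], R) \<pi> [i, j, k] \<Longrightarrow>
      is_occurrence ([1,3,2], R) (swap_entries j k \<pi>) [i, j, k]"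
    and "is_occurrence ([1,3,2], R) \<pi> [i, j, k] \<Longrightarrow>
      is_occurrence ([1,2,3], R) (swap_entries j k \<pi>) [i, j, k]"
  using assms
  by (auto simp: is_occurrence_123_iff[of _ n] is_occurrence_132_iff[of _ n] entry_swap_entries
      simp del: One_nat_def intro!: avoids_boxes_swap_entries[simplified])

lemma card_occurrence_pairs_123_132:
  assumes "R \<subseteq> {0..3} \<times> UNIV"
  shows "card (occurrence_pairs ([1,2,3], R) n) = card (occurrence_pairs ([1,3,2], R) n)"
proof (rule bij_betw_same_card)
  \<comment> \<open>The list indices 1 and 2 pick the second and third positions of the occurrence.
    Since \<open>ps\<close> is kept, the same map undoes itself and serves as its own
    inverse.\<close>
  let ?f = "\<lambda>(\<pi>, ps). (swap_entries (ps ! 1) (ps ! 2) \<pi>, ps)"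
  let ?P = "occurrence_pairs ([1,2,3], R) n" and ?Q = "occurrence_pairs ([1,3,2], R) n"
  have P: "?f x \<in> ?Q \<and> ?f (?f x) = x" if x: "x \<in> ?P" for x
  proof -
    obtain \<pi> ps where [simp]: "x = (\<pi>, ps)" by fastforce
    have \<pi>: "\<pi> \<in> permutations_of_set {1..n}" and occ: "is_occurrence ([1,2,3], R) \<pi> ps"
      using x by (auto simp: occurrence_pairs_def)
    obtain i j k where "ps = [i, j, k]" "1 \<le> j" "j < k" "k \<le> length \<pi>"
      using occ unfolding is_occurrence_123_iff[OF refl] by auto
    then show ?thesis
      using \<pi> occ is_occurrence_swap_entries(1)[OF length_permutation[OF \<pi>] assms]
      by (simp add: occurrence_pairs_def swap_entries_in_permutations_of_set
          swap_entries_swap_entries)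
  qed
  have Q: "?f x \<in> ?P \<and> ?f (?f x) = x" if x: "x \<in> ?Q" for x
  proof -
    obtain \<pi> ps where [simp]: "x = (\<pi>, ps)" by fastforce
    have \<pi>: "\<pi> \<in> permutations_of_set {1..n}" and occ: "is_occurrence ([1,3,2], R) \<pi> ps"
      using x by (auto simp: occurrence_pairs_def)
    obtain i j k where "ps = [i, j, k]" "1 \<le> j" "j < k" "k \<le> length \<pi>"
      using occ unfolding is_occurrence_132_iff[OF refl] by auto
    then show ?thesis
      using \<pi> occ is_occurrence_swap_entries(2)[OF length_permutation[OF \<pi>] assms]
      by (simp add: occurrence_pairs_def swap_entries_in_permutations_of_set
          swap_entries_swap_entries)
  qed
  show "bij_betw ?f ?P ?Q"
    by (rule bij_betw_byWitness[where f' = ?f]) (use P Q in blast)+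
qed

section \<open>From equal totals to joint equidistribution when occurrences are unique\<close>

lemma num_occurrences_unique:
  assumes "\<And>ps ps'. is_occurrence q \<pi> ps \<Longrightarrow> is_occurrence q \<pi> ps' \<Longrightarrow> ps = ps'"
  shows "num_occurrences q \<pi> = (if \<exists>ps. is_occurrence q \<pi> ps then 1 else 0)"
proof (cases "\<exists>ps. is_occurrence q \<pi> ps")
  case True
  then obtain ps where "{ps. is_occurrence q \<pi> ps} = {ps}" using assms by blast
  with True show ?thesis by (simp add: num_occurrences_def)
qed (simp add: num_occurrences_def)

text \<open>Uniqueness makes the projection of a pair to its permutation injective, and its image
  consists of the permutations that contain the pattern.\<close>

lemma card_num_occurrences_eq_1:
  assumes "\<And>\<pi> ps ps'. \<pi> \<in> permutations_of_set {1..n} \<Longrightarrow>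
    is_occurrence q \<pi> ps \<Longrightarrow> is_occurrence q \<pi> ps' \<Longrightarrow> ps = ps'"
  shows "card {\<pi> \<in> permutations_of_set {1..n}. num_occurrences q \<pi> = 1} =
    card (occurrence_pairs q n)"
proof -
  have "num_occurrences q \<pi> = 1 \<longleftrightarrow> (\<exists>ps. is_occurrence q \<pi> ps)"
    if "\<pi> \<in> permutations_of_set {1..n}" for \<pi>
    using num_occurrences_unique[OF assms[OF that]] by simp
  then have "{\<pi> \<in> permutations_of_set {1..n}. num_occurrences q \<pi> = 1} =
      fst ` occurrence_pairs q n"
    unfolding occurrence_pairs_def by (auto simp: image_iff)
  moreover have "inj_on fst (occurrence_pairs q n)"
    using assms by (auto simp: inj_on_def occurrence_pairs_def)
  ultimately show ?thesis by (simp add: card_image)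
qed

lemma jointly_equidistributed_if_unique:
  assumes "\<And>n. card (occurrence_pairs q1 n) = card (occurrence_pairs q2 n)"
    and u1: "\<And>n \<pi> ps ps'. \<pi> \<in> permutations_of_set {1..n} \<Longrightarrow>
      is_occurrence q1 \<pi> ps \<Longrightarrow> is_occurrence q1 \<pi> ps' \<Longrightarrow> ps = ps'"
    and u2: "\<And>n \<pi> ps ps'. \<pi> \<in> permutations_of_set {1..n} \<Longrightarrow>
      is_occurrence q2 \<pi> ps \<Longrightarrow> is_occurrence q2 \<pi> ps' \<Longrightarrow> ps = ps'"
  shows "q1 \<sim>\<^sub>j\<^sub>d q2"
  unfolding jointly_equidistributed_def
proof (intro allI)
  fix n k l :: nat
  let ?S = "permutations_of_set {1..n}"
  let ?f = "num_occurrences q1" and ?g = "num_occurrences q2"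
  let ?A = "{\<pi> \<in> ?S. ?f \<pi> = 1}" and ?B = "{\<pi> \<in> ?S. ?g \<pi> = 1}"
  have f: "?f \<pi> \<in> {0, 1}" and g: "?g \<pi> \<in> {0, 1}" if "\<pi> \<in> ?S" for \<pi>
    using num_occurrences_unique[OF u1[OF that]] num_occurrences_unique[OF u2[OF that]] by simp_all
  have "card ?A = card ?B"
    using assms(1) card_num_occurrences_eq_1[OF u1] card_num_occurrences_eq_1[OF u2] by simp
  then have AB: "card (?A - ?B) = card (?B - ?A)"
    by (simp add: card_Diff_subset_Int Int_commute)
  have A: "?A - ?B = {\<pi> \<in> ?S. ?f \<pi> = 1 \<and> ?g \<pi> = 0}"
    and B: "?B - ?A = {\<pi> \<in> ?S. ?f \<pi> = 0 \<and> ?g \<pi> = 1}"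
    using f g by auto
  \<comment> \<open>For \<open>k = l\<close> both sides are the same set, and a count above 1 makes
    both sets empty. Only (1,0) and (0,1) remain, where the sets are the two differences of
    \<open>?A\<close> and \<open>?B\<close>.\<close>
  consider "k = l" | "1 < k \<or> 1 < l" | "k = 1 \<and> l = 0" | "k = 0 \<and> l = 1" by linarith
  then show "card {\<pi> \<in> ?S. ?f \<pi> = k \<and> ?g \<pi> = l} = card {\<pi> \<in> ?S. ?f \<pi> = l \<and> ?g \<pi> = k}"
  proof cases
    case 2
    then have "{\<pi> \<in> ?S. ?f \<pi> = k \<and> ?g \<pi> = l} = {}" "{\<pi> \<in> ?S. ?f \<pi> = l \<and> ?g \<pi> = k} = {}"
      using f g by force+
    then show ?thesis by (simp only:)
  qed (use AB A B in simp_all)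
qed

section \<open>Uniqueness of occurrences, for the letters seen as a bijection of {1..n}\<close>

lemma entry_permutation:
  assumes "\<pi> \<in> permutations_of_set {1..n}"
  shows "inj_on (entry \<pi>) {1..n}" "entry \<pi> ` {1..n} = {1..n}"
proof -
  have len: "length \<pi> = n" and "distinct \<pi>" and set: "set \<pi> = {1..n}"
    using assms by (auto simp: length_permutation permutations_of_set_def)
  then show "inj_on (entry \<pi>) {1..n}"
    by (auto simp: inj_on_def entry_def nth_eq_iff_index_eq)
  have "entry \<pi> ` {1..n} \<subseteq> {1..n}"
    using len set nth_mem by (fastforce simp: entry_def)
  with \<open>inj_on (entry \<pi>) {1..n}\<close> show "entry \<pi> ` {1..n} = {1..n}"
    by (intro endo_inj_surj) auto
qed

context
  fixes n :: nat and e :: "nat \<Rightarrow> nat"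
  assumes inj: "inj_on e {1..n}" and surj: "e ` {1..n} = {1..n}"
begin

lemma e_eq_iff: "1 \<le> m \<Longrightarrow> m \<le> n \<Longrightarrow> 1 \<le> l \<Longrightarrow> l \<le> n \<Longrightarrow> e m = e l \<longleftrightarrow> m = l"
  by (simp add: inj_on_eq_iff[OF inj])

lemma e_bounds: "1 \<le> m \<Longrightarrow> m \<le> n \<Longrightarrow> 1 \<le> e m \<and> e m \<le> n"
  using imageI[of m "{1..n}" e] unfolding surj by simp

text \<open>The shaded last column fixes \<open>k\<close>. The position \<open>i\<close> is then
  forced by comparing two occurrences, and \<open>e j\<close> is the largest letter below
  \<open>e n\<close> to the right of \<open>i\<close>.\<close>

lemma unique_123_R:
  assumes R: "R = {(0,0), (0,1), (2,0), (3,0), (1,2), (2,2), (3,1), (3,2), (3,3)}"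
    and occ: "1 \<le> i" "i < j" "j < k" "k \<le> n" "e i < e j" "e j < e k"
      "avoids_boxes R n e [0, i, j, k, n + 1] [0, e i, e j, e k, n + 1]"
    and occ': "1 \<le> i'" "i' < j'" "j' < k'" "k' \<le> n" "e i' < e j'" "e j' < e k'"
      "avoids_boxes R n e [0, i', j', k', n + 1] [0, e i', e j', e k', n + 1]"
  shows "i = i' \<and> j = j' \<and> k = k'"
proof -
  have last: "k = n" and before: "\<forall>m\<ge>1. m < i \<longrightarrow> e j < e m"
    and mid: "\<forall>m>i. m \<le> n \<longrightarrow> e m \<le> e j \<or> e k \<le> e m"
    and after: "\<forall>m>j. m \<le> n \<longrightarrow> e i \<le> e m"
    if occ: "1 \<le> i" "i < j" "j < k" "k \<le> n" "e i < e j" "e j < e k"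
      "avoids_boxes R n e [0, i, j, k, n + 1] [0, e i, e j, e k, n + 1]" for i j k
  proof -
    note box = avoids_boxesD[OF occ(7)]
    \<comment> \<open>If \<open>k < n\<close>, position \<open>n\<close> lies in the last column,
      where all four boxes are shaded. Its letter would have to lie on a grid line, against
      injectivity and the bounds on \<open>e\<close>.\<close>
    show k: "k = n"
      using box[of 3 0 n] box[of 3 1 n] box[of 3 2 n] box[of 3 3 n] occ(1-6)
        e_eq_iff[of n i] e_eq_iff[of n j] e_eq_iff[of n k] e_bounds[of n]
      by (auto simp: R)
    show "\<forall>m\<ge>1. m < i \<longrightarrow> e j < e m"
    proof (intro allI impI)
      fix m assume "1 \<le> m" "m < i"
      then show "e j < e m"
        using box[of 0 0 m] box[of 0 1 m] occ(1-6)
          e_eq_iff[of m i] e_eq_iff[of m j] e_bounds[of m]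
        by (auto simp: R)
    qed
    show "\<forall>m>i. m \<le> n \<longrightarrow> e m \<le> e j \<or> e k \<le> e m"
    proof (intro allI impI)
      fix m assume "i < m" "m \<le> n"
      then show "e m \<le> e j \<or> e k \<le> e m"
        using box[of 1 2 m] box[of 2 2 m] occ(1-6) k
        by (cases "m < j"; cases "m = j"; cases "m = k") (auto simp: R)
    qed
    show "\<forall>m>j. m \<le> n \<longrightarrow> e i \<le> e m"
    proof (intro allI impI)
      fix m assume "j < m" "m \<le> n"
      then show "e i \<le> e m"
        using box[of 2 0 m] occ(1-6) k e_bounds[of m]
        by (cases "m = k") (auto simp: R)
    qed
  qed
  note fs = last[OF occ] before[OF occ] mid[OF occ] after[OF occ]
  note fs' = last[OF occ'] before[OF occ'] mid[OF occ'] after[OF occ']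
  \<comment> \<open>Suppose \<open>i < i'\<close>. Then \<open>before\<close> gives
    \<open>e j' < e i < e j\<close>, so by \<open>mid\<close> for the primed occurrence
    \<open>j\<close> cannot lie after \<open>i'\<close>, whence \<open>j < i'\<close>. But
    \<open>e i' < e i\<close> contradicts \<open>after\<close>. The other case is symmetric.\<close>
  have "i = i'"
    using fs fs' occ(1-6) occ'(1-6)
    by (smt (verit) le_trans less_imp_le_nat linorder_neqE_nat not_le)
  \<comment> \<open>Both \<open>j\<close> and \<open>j'\<close> lie right of the common
    \<open>i\<close> and carry letters below \<open>e n\<close>, so \<open>mid\<close> bounds each
    of the two letters by the other.\<close>
  moreover have "e j = e j'"
    using fs fs' occ(1-6) occ'(1-6) calculation
    by (smt (verit) le_antisym le_trans less_imp_le_nat not_le)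
  ultimately show ?thesis
    using e_eq_iff[of j j'] fs(1) fs'(1) occ(1-4) occ'(1-4) by auto
qed

text \<open>Again \<open>k = n\<close>. As \<open>e i < e n\<close> and all earlier letters exceed
  \<open>e n\<close>, \<open>i\<close> is the first position with a letter below \<open>e n\<close>;
  then \<open>e j\<close> is the smallest letter above \<open>e n\<close> to the right of
  \<open>i\<close>.\<close>

lemma unique_132_R:
  assumes R: "R = {(0,0), (0,1), (2,0), (3,0), (1,2), (2,2), (3,1), (3,2), (3,3)}"
    and occ: "1 \<le> i" "i < j" "j < k" "k \<le> n" "e i < e k" "e k < e j"
      "avoids_boxes R n e [0, i, j, k, n + 1] [0, e i, e k, e j, n + 1]"
    and occ': "1 \<le> i'" "i' < j'" "j' < k'" "k' \<le> n" "e i' < e k'" "e k' < e j'"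
      "avoids_boxes R n e [0, i', j', k', n + 1] [0, e i', e k', e j', n + 1]"
  shows "i = i' \<and> j = j' \<and> k = k'"
proof -
  have last: "k = n" and before: "\<forall>m\<ge>1. m < i \<longrightarrow> e k < e m"
    and mid: "\<forall>m>i. m \<le> n \<longrightarrow> e m \<le> e k \<or> e j \<le> e m"
    if occ: "1 \<le> i" "i < j" "j < k" "k \<le> n" "e i < e k" "e k < e j"
      "avoids_boxes R n e [0, i, j, k, n + 1] [0, e i, e k, e j, n + 1]" for i j k
  proof -
    note box = avoids_boxesD[OF occ(7)]
    show k: "k = n"
      using box[of 3 0 n] box[of 3 1 n] box[of 3 2 n] box[of 3 3 n] occ(1-6)
        e_eq_iff[of n i] e_eq_iff[of n j] e_eq_iff[of n k] e_bounds[of n]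
      by (auto simp: R)
    show "\<forall>m\<ge>1. m < i \<longrightarrow> e k < e m"
    proof (intro allI impI)
      fix m assume "1 \<le> m" "m < i"
      then show "e k < e m"
        using box[of 0 0 m] box[of 0 1 m] occ(1-6)
          e_eq_iff[of m i] e_eq_iff[of m k] e_bounds[of m]
        by (auto simp: R)
    qed
    show "\<forall>m>i. m \<le> n \<longrightarrow> e m \<le> e k \<or> e j \<le> e m"
    proof (intro allI impI)
      fix m assume "i < m" "m \<le> n"
      then show "e m \<le> e k \<or> e j \<le> e m"
        using box[of 1 2 m] box[of 2 2 m] occ(1-6) k
        by (cases "m < j"; cases "m = j"; cases "m = k") (auto simp: R)
    qed
  qed
  note fs = last[OF occ] before[OF occ] mid[OF occ]
  note fs' = last[OF occ'] before[OF occ'] mid[OF occ']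
  have "i = i'"
    using fs fs' occ(1-6) occ'(1-6) by (metis less_asym linorder_neqE_nat)
  moreover have "e j = e j'"
    using fs fs' occ(1-6) occ'(1-6) calculation
    by (smt (verit) le_antisym le_trans less_imp_le_nat not_le)
  ultimately show ?thesis
    using e_eq_iff[of j j'] fs(1) fs'(1) occ(1-4) occ'(1-4) by auto
qed

text \<open>This shading is the transpose of the one in \<open>unique_123_R\<close>, and 123 is its
  own inverse. The four facts below are accordingly the earlier ones with positions and values
  exchanged; in particular the full top row gives \<open>e k = n\<close>.\<close>

lemma unique_123_R':
  assumes R: "R = {(0,0), (1,0), (0,2), (0,3), (1,3), (2,1), (2,2), (2,3), (3,3)}"
    and occ: "1 \<le> i" "i < j" "j < k" "k \<le> n" "e i < e j" "e j < e k"
      "avoids_boxes R n e [0, i, j, k, n + 1] [0, e i, e j, e k, n + 1]"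
    and occ': "1 \<le> i'" "i' < j'" "j' < k'" "k' \<le> n" "e i' < e j'" "e j' < e k'"
      "avoids_boxes R n e [0, i', j', k', n + 1] [0, e i', e j', e k', n + 1]"
  shows "i = i' \<and> j = j' \<and> k = k'"
proof -
  have top: "e k = n" and before: "\<forall>m\<ge>1. m < j \<longrightarrow> e i \<le> e m"
    and left: "\<forall>m\<ge>1. m < i \<longrightarrow> e m < e j"
    and mid: "\<forall>m>j. m < k \<longrightarrow> e m < e i"
    if occ: "1 \<le> i" "i < j" "j < k" "k \<le> n" "e i < e j" "e j < e k"
      "avoids_boxes R n e [0, i, j, k, n + 1] [0, e i, e j, e k, n + 1]" for i j k
  proof -
    note box = avoids_boxesD[OF occ(7)]
    \<comment> \<open>The letter \<open>n\<close> sits at some position \<open>m\<close>. Since the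
      top row is shaded in every column, it cannot lie strictly above \<open>e k\<close>.\<close>
    have "n \<in> e ` {1..n}" using surj occ(1-4) by simp
    then obtain m where m: "e m = n" "1 \<le> m" "m \<le> n" by auto
    consider "m < i" | "i < m" "m < j" | "j < m" "m < k" | "k < m" | "m = i \<or> m = j \<or> m = k"
      by linarith
    then have "e m \<le> e k"
    proof cases
      case 1 then show ?thesis using box[of 0 3 m] m by (simp add: R)
    next
      case 2 then show ?thesis using box[of 1 3 m] m by (simp add: R)
    next
      case 3 then show ?thesis using box[of 2 3 m] m by (simp add: R)
    next
      case 4 then show ?thesis using box[of 3 3 m] m by (simp add: R)
    next
      case 5 then show ?thesis using occ(5,6) by auto
    qed
    then show top: "e k = n" using m e_bounds[of k] occ(1-4) by simp
    show "\<forall>m\<ge>1. m < j \<longrightarrow> e i \<le> e m"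
    proof (intro allI impI)
      fix m assume "1 \<le> m" "m < j"
      then show "e i \<le> e m"
        using box[of 0 0 m] box[of 1 0 m] occ(1-6) e_bounds[of m]
        by (cases "m < i"; cases "m = i") (auto simp: R)
    qed
    show "\<forall>m\<ge>1. m < i \<longrightarrow> e m < e j"
    proof (intro allI impI)
      fix m assume "1 \<le> m" "m < i"
      then show "e m < e j"
        using box[of 0 2 m] box[of 0 3 m] occ(1-6) top e_bounds[of m]
          e_eq_iff[of m j] e_eq_iff[of m k]
        by (auto simp: R)
    qed
    show "\<forall>m>j. m < k \<longrightarrow> e m < e i"
    proof (intro allI impI)
      fix m assume "j < m" "m < k"
      then show "e m < e i"
        using box[of 2 1 m] box[of 2 2 m] box[of 2 3 m] occ(1-6) top e_bounds[of m]
          e_eq_iff[of m i] e_eq_iff[of m j] e_eq_iff[of m k]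
        by (auto simp: R)
    qed
  qed
  note fs = before[OF occ] left[OF occ] mid[OF occ]
  note fs' = before[OF occ'] left[OF occ'] mid[OF occ']
  have k: "k = k'" using top[OF occ] top[OF occ'] occ(1-4) occ'(1-4) e_eq_iff[of k k'] by simp
  \<comment> \<open>Suppose \<open>e i < e i'\<close>. Then \<open>before\<close> for the primed
    occurrence forces \<open>j' < i\<close>, so \<open>left\<close> gives \<open>e j' < e j\<close>.
    But \<open>j\<close> lies between \<open>j'\<close> and the common \<open>k\<close>, so
    \<open>mid\<close> gives \<open>e j < e i' < e j'\<close>, a contradiction.\<close>
  have "e i = e i'"
    using fs fs' k occ(1-6) occ'(1-6)
    by (smt (verit) le_trans less_imp_le_nat linorder_neqE_nat not_le)
  then have i: "i = i'" using e_eq_iff[of i i'] occ(1-4) occ'(1-4) by simp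
  \<comment> \<open>By \<open>mid\<close>, \<open>j\<close> is the last position before
    \<open>k\<close> whose letter exceeds \<open>e i\<close>.\<close>
  have "j = j'"
    using fs fs' k i occ(1-6) occ'(1-6) by (metis less_asym linorder_neqE_nat)
  with i k show ?thesis by simp
qed

text \<open>The full top row makes \<open>j\<close> the position of \<open>n\<close>. Then
  \<open>e i\<close> is the least letter before \<open>j\<close>, and \<open>k\<close> is the first
  position after \<open>j\<close> with a letter above \<open>e i\<close>.\<close>

lemma unique_132_R':
  assumes R: "R = {(0,0), (1,0), (0,2), (0,3), (1,3), (2,1), (2,2), (2,3), (3,3)}"
    and occ: "1 \<le> i" "i < j" "j < k" "k \<le> n" "e i < e k" "e k < e j"
      "avoids_boxes R n e [0, i, j, k, n + 1] [0, e i, e k, e j, n + 1]"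
    and occ': "1 \<le> i'" "i' < j'" "j' < k'" "k' \<le> n" "e i' < e k'" "e k' < e j'"
      "avoids_boxes R n e [0, i', j', k', n + 1] [0, e i', e k', e j', n + 1]"
  shows "i = i' \<and> j = j' \<and> k = k'"
proof -
  have top: "e j = n" and before: "\<forall>m\<ge>1. m < j \<longrightarrow> e i \<le> e m"
    and mid: "\<forall>m>j. m < k \<longrightarrow> e m < e i"
    if occ: "1 \<le> i" "i < j" "j < k" "k \<le> n" "e i < e k" "e k < e j"
      "avoids_boxes R n e [0, i, j, k, n + 1] [0, e i, e k, e j, n + 1]" for i j k
  proof -
    note box = avoids_boxesD[OF occ(7)]
    have "n \<in> e ` {1..n}" using surj occ(1-4) by simp
    then obtain m where m: "e m = n" "1 \<le> m" "m \<le> n" by auto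
    consider "m < i" | "i < m" "m < j" | "j < m" "m < k" | "k < m" | "m = i \<or> m = j \<or> m = k"
      by linarith
    then have "e m \<le> e j"
    proof cases
      case 1 then show ?thesis using box[of 0 3 m] m by (simp add: R)
    next
      case 2 then show ?thesis using box[of 1 3 m] m by (simp add: R)
    next
      case 3 then show ?thesis using box[of 2 3 m] m by (simp add: R)
    next
      case 4 then show ?thesis using box[of 3 3 m] m by (simp add: R)
    next
      case 5 then show ?thesis using occ(5,6) by auto
    qed
    then show top: "e j = n" using m e_bounds[of j] occ(1-4) by simp
    show "\<forall>m\<ge>1. m < j \<longrightarrow> e i \<le> e m"
    proof (intro allI impI)
      fix m assume "1 \<le> m" "m < j"
      then show "e i \<le> e m"
        using box[of 0 0 m] box[of 1 0 m] occ(1-6) e_bounds[of m]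
        by (cases "m < i"; cases "m = i") (auto simp: R)
    qed
    show "\<forall>m>j. m < k \<longrightarrow> e m < e i"
    proof (intro allI impI)
      fix m assume "j < m" "m < k"
      then show "e m < e i"
        using box[of 2 1 m] box[of 2 2 m] box[of 2 3 m] occ(1-6) top e_bounds[of m]
          e_eq_iff[of m i] e_eq_iff[of m j] e_eq_iff[of m k]
        by (auto simp: R)
    qed
  qed
  note fs = before[OF occ] mid[OF occ]
  note fs' = before[OF occ'] mid[OF occ']
  have j: "j = j'" using top[OF occ] top[OF occ'] occ(1-4) occ'(1-4) e_eq_iff[of j j'] by simp
  have "e i = e i'"
    using fs fs' j occ(1,2) occ'(1,2) by (simp add: le_antisym)
  then have i: "i = i'" using e_eq_iff[of i i'] occ(1-4) occ'(1-4) by simp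
  have "k = k'"
    using fs fs' j i occ(1-6) occ'(1-6) by (metis less_asym linorder_neqE_nat)
  with i j show ?thesis by simp
qed

end

section \<open>Combining equal totals with uniqueness for the two shadings\<close>

theorem theorem5p2:
  fixes R R' :: "(nat \<times> nat) set"
  assumes "R = {(0,0), (0,1), (2,0), (3,0), (1,2), (2,2), (3,1), (3,2), (3,3)}"
    and "R' = {(0,0), (1,0), (0,2), (0,3), (1,3), (2,1), (2,2), (2,3), (3,3)}"
  shows "([1,2,3], R) \<sim>\<^sub>j\<^sub>d ([1,3,2], R) \<and> ([1,2,3], R') \<sim>\<^sub>j\<^sub>d ([1,3,2], R')"
proof
  show "([1,2,3], R) \<sim>\<^sub>j\<^sub>d ([1,3,2], R)"
  proof (rule jointly_equidistributed_if_unique)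
    show "card (occurrence_pairs ([1,2,3], R) n) = card (occurrence_pairs ([1,3,2], R) n)" for n
      by (rule card_occurrence_pairs_123_132) (simp add: assms)
  next
    fix n :: nat and \<pi> ps ps' assume \<pi>: "\<pi> \<in> permutations_of_set {1..n}"
    note iff = is_occurrence_123_iff[OF length_permutation[OF \<pi>]]
      is_occurrence_132_iff[OF length_permutation[OF \<pi>]]
    show "ps = ps'"
      if "is_occurrence ([1,2,3], R) \<pi> ps" "is_occurrence ([1,2,3], R) \<pi> ps'"
      using that unique_123_R[OF entry_permutation[OF \<pi>] assms(1)] unfolding iff by blast
    show "ps = ps'"
      if "is_occurrence ([1,3,2], R) \<pi> ps" "is_occurrence ([1,3,2], R) \<pi> ps'"
      using that unique_132_R[OF entry_permutation[OF \<pi>] assms(1)] unfolding iff by blast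
  qed
next
  show "([1,2,3], R') \<sim>\<^sub>j\<^sub>d ([1,3,2], R')"
  proof (rule jointly_equidistributed_if_unique)
    show "card (occurrence_pairs ([1,2,3], R') n) = card (occurrence_pairs ([1,3,2], R') n)" for n
      by (rule card_occurrence_pairs_123_132) (simp add: assms)
  next
    fix n :: nat and \<pi> ps ps' assume \<pi>: "\<pi> \<in> permutations_of_set {1..n}"
    note iff = is_occurrence_123_iff[OF length_permutation[OF \<pi>]]
      is_occurrence_132_iff[OF length_permutation[OF \<pi>]]
    show "ps = ps'"
      if "is_occurrence ([1,2,3], R') \<pi> ps" "is_occurrence ([1,2,3], R') \<pi> ps'"
      using that unique_123_R'[OF entry_permutation[OF \<pi>] assms(2)] unfolding iff by blast
    show "ps = ps'"
      if "is_occurrence ([1,3,2], R') \<pi> ps" "is_occurrence ([1,3,2], R') \<pi> ps'"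
      using that unique_132_R'[OF entry_permutation[OF \<pi>] assms(2)] unfolding iff by blast
  qed
qed

end
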